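(* Let $s,t$ be integers with $0<t<s$. There exists $n_0=n_0(s,t)$ such that the following holds for every $n\ge n_0$. For integers $a\ge 0$ put $\alpha_n(a):=s-t-a^2-\mathbb{1}_{\{n \text{ odd}\}}\,a$ and let $I_n=\{a\in\mathbb{Z}_{\ge 0}:\alpha_n(a)\ge 0\}$. Define \[ T_3(G_1):=\min_{a\in I_n}\Big[(s-1)\big(\lfloor n/2\rfloor-a\big)+\big(\lceil n/2\rceil+a\big)-2\alpha_n(a)\Big],\qquad T_3(G_2):=\min_{a\in I_n}\Big[s\big(\lfloor n/2\rfloor-a\big)-\alpha_n(a)\Big]. \] If $G$ is a graph on $n$ vertices with $\lfloor n^2/4\rfloor+t$ edges and triangle covering number $\tau_3(G)\ge s$, then $G$ contains at least $\min\{T_3(G_1),T_3(G_2)\}$ triangles.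
   Context: A triangle covering set of a graph $G$ is a set of vertices meeting every triangle of $G$; the triangle covering number $\tau_3(G)$ is the minimum size of such a set. $\mathbb{1}_{\{n\text{ odd}\}}$ equals $1$ if $n$ is odd and $0$ otherwise. (The two quantities are the triangle counts of the following constructions, with $a\in I_n$ chosen optimally. $G_1$: take $K_{|A|,|B|}$ with $|A|=\lceil n/2\rceil+a$, $|B|=\lfloor n/2\rfloor-a$; add $s-1$ disjoint edges $x_1y_1,\dots,x_{s-1}y_{s-1}$ inside $A$ and one edge $u_1u_2$ inside $B$; delete the edges $u_1x_1,\dots,u_1x_{\alpha_n(a)}$. $G_2$: same bipartition, add $s$ disjoint edges $x_1y_1,\dots,x_sy_s$ inside $A$, pick $u\in B$ and delete $ux_1,\dots,ux_{\alpha_n(a)}$. Both have $\lfloor n^2/4\rfloor+t$ edges and triangle covering number $s$.) *)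

theory Defs
  imports Complex_Main "HOL-Library.Ramsey"
begin

text \<open>
  A graph is given by its vertex set and a set of two-element subsets of it;
  \<^term>\<open>nsets V k\<close> is the set of \<open>k\<close>-element subsets of \<open>V\<close>.
\<close>

definition finite_simple_graph :: "'a set \<Rightarrow> 'a set set \<Rightarrow> bool" where
  "finite_simple_graph V E \<longleftrightarrow> finite V \<and> E \<subseteq> nsets V 2"

definition triangles :: "'a set \<Rightarrow> 'a set set \<Rightarrow> 'a set set" where
  "triangles V E = {T \<in> nsets V 3. clique T E}"

definition triangle_covering_set :: "'a set \<Rightarrow> 'a set set \<Rightarrow> 'a set \<Rightarrow> bool" where
  "triangle_covering_set V E X \<longleftrightarrow> X \<subseteq> V \<and> (\<forall>T \<in> triangles V E. X \<inter> T \<noteq> {})"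

definition tau3 :: "'a set \<Rightarrow> 'a set set \<Rightarrow> nat" where
  "tau3 V E = Min (card ` {X. triangle_covering_set V E X})"

definition alpha :: "nat \<Rightarrow> nat \<Rightarrow> nat \<Rightarrow> nat \<Rightarrow> int" where
  "alpha s t n a = int s - int t - (int a)\<^sup>2 - of_bool (odd n) * int a"

definition I_set :: "nat \<Rightarrow> nat \<Rightarrow> nat \<Rightarrow> nat set" where
  "I_set s t n = {a. alpha s t n a \<ge> 0}"

text \<open>
  For \<open>t \<le> s\<close> the set \<^term>\<open>I_set s t n\<close> is finite and contains \<open>0\<close>, so the minima below are
  attained. All arithmetic is over the integers, so no subtraction is truncated.
\<close>

definition T3_G1 :: "nat \<Rightarrow> nat \<Rightarrow> nat \<Rightarrow> int" where
  "T3_G1 s t n =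
     (MIN a \<in> I_set s t n.
        (int s - 1) * (\<lfloor>real n / 2\<rfloor> - int a) + (\<lceil>real n / 2\<rceil> + int a) - 2 * alpha s t n a)"

definition T3_G2 :: "nat \<Rightarrow> nat \<Rightarrow> nat \<Rightarrow> int" where
  "T3_G2 s t n =
     (MIN a \<in> I_set s t n. int s * (\<lfloor>real n / 2\<rfloor> - int a) - alpha s t n a)"

end

(*
  Let T be the number of triangles; we may assume 2 T <= s n. Averaging
  d(u) + d(v) - n, the number of triangles at u and at v, and the codegree over all edges uv
  yields an edge whose two endpoints lie in O(1) triangles and whose neighbourhoods cover all
  but O(1) vertices. Hence N(u) and its complement form a cut with only O(n) inner edges.

  In a cut (A, B) with fewest inner edges at most as many cross pairs are missing as there are
  inner edges, since |E| >= n^2/4. A vertex of inner degree d has at least d neighbours on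
  the other side, so d^2 <= T + #missing = O(n). An inner edge together with any vertex of the
  other side is a triangle unless a cross pair is missing, and each missing pair spoils at most
  2 max d = O(sqrt n) of these combinations. So every inner edge accounts for n/2 - O(sqrt n)
  triangles, which leaves room for at most s inner edges.

  Every triangle contains an inner edge, so covering number >= s forces exactly s inner
  edges, forming a matching. If |A| = ceil(n/2) + a, exactly alpha(a) cross pairs are missing, and
  each of them spoils at most one triangle if all inner edges lie on one side (giving G2), and at
  most two otherwise (giving G1).
*)

theory Submission
  imports Defs
begin

section \<open>Edges, triangles and neighbourhoods in a finite simple graph\<close>

locale simple_graph =
  fixes V :: "'a set" and E :: "'a set set"
  assumes graph: "finite_simple_graph V E"
begin

lemma finite_V [simp]: "finite V"
  and E_subset: "E \<subseteq> nsets V 2"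
  using graph by (auto simp: finite_simple_graph_def)

lemma finite_E [simp]: "finite E"
  using E_subset finite_imp_finite_nsets[OF finite_V] finite_subset by blast

lemma edgeD:
  assumes "{x, y} \<in> E"
  shows "x \<in> V" "y \<in> V" "x \<noteq> y"
proof -
  have "{x, y} \<in> nsets V 2" using assms E_subset by blast
  then show "x \<in> V" "y \<in> V" "x \<noteq> y" by (auto simp: nsets_def card_insert_if split: if_splits)
qed

lemma edgeE:
  assumes "e \<in> E"
  obtains x y where "e = {x, y}" "x \<noteq> y" "x \<in> V" "y \<in> V"
proof -
  have "e \<in> nsets V 2" using assms E_subset by blast
  then show ?thesis using that by (auto simp: nsets_def card_2_iff)
qed

lemma edge_subset: "e \<in> E \<Longrightarrow> e \<subseteq> V"
  by (erule edgeE) auto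

lemma finite_triangles [simp]: "finite (triangles V E)"
  unfolding triangles_def using finite_imp_finite_nsets[OF finite_V] by simp

lemma triangleI:
  assumes "{x, y} \<in> E" "{x, z} \<in> E" "{y, z} \<in> E"
  shows "{x, y, z} \<in> triangles V E"
  using assms[THEN edgeD(1)] assms[THEN edgeD(2)] assms[THEN edgeD(3)] assms
  by (auto simp: triangles_def nsets_def clique_def insert_commute)

lemma triangleE:
  assumes "T \<in> triangles V E"
  obtains x y z where "T = {x, y, z}" "{x, y} \<in> E" "{x, z} \<in> E" "{y, z} \<in> E"
proof -
  have "card T = 3" "clique T E" using assms by (auto simp: triangles_def nsets_def)
  then obtain x y z where "T = {x, y, z}" "x \<noteq> y" "x \<noteq> z" "y \<noteq> z"
    by (metis card_3_iff)
  with \<open>clique T E\<close> show ?thesis using that by (auto simp: clique_def)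
qed

definition nbhd :: "'a \<Rightarrow> 'a set" where
  "nbhd x = {y. {x, y} \<in> E}"

lemma nbhd_iff: "y \<in> nbhd x \<longleftrightarrow> {x, y} \<in> E"
  by (simp add: nbhd_def)

lemma nbhd_subset: "nbhd x \<subseteq> V"
  using edgeD by (auto simp: nbhd_def)

lemma finite_nbhd [simp]: "finite (nbhd x)"
  using nbhd_subset finite_subset finite_V by blast

section \<open>Sums over arcs (ordered adjacent pairs) and averaging\<close>

lemma handshake: "(\<Sum>x\<in>V. card (nbhd x)) = 2 * card E"
proof -
  have fib: "card {p \<in> Sigma V nbhd. {fst p, snd p} = e} = 2" if "e \<in> E" for e
  proof -
    obtain x y where e: "e = {x, y}" "x \<noteq> y" "x \<in> V" "y \<in> V"
      using \<open>e \<in> E\<close> by (rule edgeE)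
    have "{p \<in> Sigma V nbhd. {fst p, snd p} = e} = {(x, y), (y, x)}"
      using e \<open>e \<in> E\<close> by (auto simp: nbhd_iff doubleton_eq_iff insert_commute)
    then show ?thesis using e by simp
  qed
  have "(\<Sum>x\<in>V. card (nbhd x)) = card (Sigma V nbhd)" by simp
  also have "\<dots> = (\<Sum>p\<in>Sigma V nbhd. 1)" by simp
  also have "\<dots> = (\<Sum>e\<in>E. \<Sum>p\<in>{p \<in> Sigma V nbhd. {fst p, snd p} = e}. 1)"
    by (rule sum.group[symmetric]) (auto simp: nbhd_iff intro!: finite_SigmaI)
  also have "\<dots> = (\<Sum>e\<in>E. 2)" using fib by (intro sum.cong) auto
  finally show ?thesis by simp
qed

text \<open>Twice the number of triangles through \<open>u\<close>.\<close>

definition wt :: "'a \<Rightarrow> nat" where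
  "wt u = (\<Sum>v\<in>nbhd u. card (nbhd u \<inter> nbhd v))"

text \<open>The left side counts ordered triples of mutually adjacent vertices. Each lies in
  \<open>T \<times> T \<times> T\<close> for its triangle \<open>T\<close>; this crude inclusion
  gives 27 instead of the exact 6.\<close>

lemma sum_wt_le: "(\<Sum>u\<in>V. wt u) \<le> 27 * card (triangles V E)"
proof -
  let ?Q = "Sigma V (\<lambda>u. Sigma (nbhd u) (\<lambda>v. nbhd u \<inter> nbhd v))"
  have "(\<Sum>u\<in>V. wt u) = card ?Q" by (simp add: wt_def)
  also have "\<dots> \<le> card (\<Union>T\<in>triangles V E. T \<times> T \<times> T)"
  proof (rule card_mono)
    show "finite (\<Union>T\<in>triangles V E. T \<times> T \<times> T)"
      by (rule finite_UN_I) (auto simp: triangles_def nsets_def)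
    show "?Q \<subseteq> (\<Union>T\<in>triangles V E. T \<times> T \<times> T)"
    proof clarify
      fix x y z assume "y \<in> nbhd x" "z \<in> nbhd x" "z \<in> nbhd y"
      then have "{x, y, z} \<in> triangles V E" by (intro triangleI) (auto simp: nbhd_iff)
      then show "(x, y, z) \<in> (\<Union>T\<in>triangles V E. T \<times> T \<times> T)" by blast
    qed
  qed
  also have "\<dots> \<le> (\<Sum>T\<in>triangles V E. card (T \<times> T \<times> T))"
    by (rule card_UN_le) simp
  also have "\<dots> = (\<Sum>T\<in>triangles V E. 27)"
    by (intro sum.cong) (auto simp: triangles_def nsets_def card_cartesian_product)
  finally show ?thesis by simp
qed

lemma sum_arcs_fst:
  fixes f :: "'a \<Rightarrow> real"
  shows "(\<Sum>(u, v)\<in>Sigma V nbhd. f u) = (\<Sum>u\<in>V. real (card (nbhd u)) * f u)"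
  by (subst sum.Sigma[symmetric]) auto

lemma sum_arcs_snd:
  fixes f :: "'a \<Rightarrow> real"
  shows "(\<Sum>(u, v)\<in>Sigma V nbhd. f v) = (\<Sum>u\<in>V. real (card (nbhd u)) * f u)"
proof -
  have "(\<Sum>(u, v)\<in>Sigma V nbhd. f v) = (\<Sum>(u, v)\<in>Sigma V nbhd. f u)"
    by (rule sum.reindex_bij_witness[where i = prod.swap and j = prod.swap])
      (auto simp: nbhd_iff insert_commute dest: edgeD)
  then show ?thesis by (simp add: sum_arcs_fst)
qed

text \<open>Over all arcs, d(u) + d(v) - n has nonnegative sum, while the two triangle weights plus
  twice the codegree average at most \<open>216 * c\<close>. So on some arc the first quantity is at
  least the second minus \<open>216 * c\<close>. Since d(u) + d(v) is the size of the union of the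
  neighbourhoods plus the codegree, and the union has at most n vertices, both bounds
  follow.\<close>

lemma exists_good_arc:
  fixes c :: real
  assumes e: "real (card V) ^ 2 \<le> 4 * real (card E)" and "E \<noteq> {}"
    and T: "real (card (triangles V E)) \<le> c * real (card V)"
  obtains u v where "{u, v} \<in> E"
    "real (wt u) + real (wt v) \<le> 216 * c"
    "real (card V) - 216 * c \<le> real (card (nbhd u \<union> nbhd v))"
proof -
  let ?n = "real (card V)" and ?d = "\<lambda>u. real (card (nbhd u))" and ?P = "Sigma V nbhd"
  let ?T = "real (card (triangles V E))" and ?e = "real (card E)"
  let ?cd = "\<lambda>u v. real (card (nbhd u \<inter> nbhd v))"
  have cardP: "real (card ?P) = 2 * ?e" using handshake by simp
  have hs: "(\<Sum>u\<in>V. ?d u) = 2 * ?e"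
    using handshake by (metis of_nat_sum of_nat_mult of_nat_numeral)
  have finP: "finite ?P" by (intro finite_SigmaI) auto
  have e0: "0 < ?e" using \<open>E \<noteq> {}\<close> by (simp add: card_gt_0_iff)
  have neP: "?P \<noteq> {}"
  proof
    assume "?P = {}"
    then have "real (card ?P) = 0" by (simp only: card.empty of_nat_0)
    then show False using cardP e0 by linarith
  qed
  have c1: "(\<Sum>(u, v)\<in>?P. ?d u + ?d v - ?n) = 2 * (\<Sum>u\<in>V. (?d u)^2) - 2 * ?e * ?n"
    using sum_arcs_fst[of ?d] sum_arcs_snd[of ?d] cardP
    by (simp add: case_prod_unfold sum.distrib sum_subtractf power2_eq_square)
  \<comment> \<open>Expanding squares around n/2 plays the role of Cauchy-Schwarz. Inserted in
    \<open>c1\<close> it bounds the arc sum below by n(4|E| - n^2)/2, which is nonnegative by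
    \<open>e\<close>.\<close>
  have "0 \<le> (\<Sum>u\<in>V. (?d u - ?n / 2)^2)" by (simp add: sum_nonneg)
  also have "\<dots> = (\<Sum>u\<in>V. (?d u)^2) - ?n * (\<Sum>u\<in>V. ?d u) + ?n * (?n / 2)^2"
    by (simp add: power2_diff sum.distrib sum_subtractf sum_distrib_left mult.commute)
  finally have c2: "(\<Sum>u\<in>V. (?d u)^2) \<ge> 2 * ?e * ?n - ?n * (?n / 2)^2"
    by (simp add: hs algebra_simps)
  have c3: "?n * (4 * ?e - ?n^2) \<ge> 0" using e by simp
  have lower: "0 \<le> (\<Sum>(u, v)\<in>?P. ?d u + ?d v - ?n)"
    unfolding c1 using c2 c3 by (simp add: power2_eq_square algebra_simps)
  have w: "(\<Sum>u\<in>V. real (wt u)) \<le> 27 * ?T"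
    using sum_wt_le by (metis of_nat_le_iff of_nat_sum of_nat_mult of_nat_numeral)
  have d_le: "?d u \<le> ?n" for u
    by (simp add: card_mono nbhd_subset)
  have "(\<Sum>u\<in>V. ?d u * real (wt u)) \<le> (\<Sum>u\<in>V. ?n * real (wt u))"
    by (intro sum_mono mult_right_mono d_le) simp
  also have "\<dots> = ?n * (\<Sum>u\<in>V. real (wt u))" by (simp add: sum_distrib_left)
  also have "\<dots> \<le> ?n * (27 * ?T)" by (intro mult_left_mono w) simp
  finally have dw: "(\<Sum>u\<in>V. ?d u * real (wt u)) \<le> ?n * (27 * ?T)" .
  have cd: "(\<Sum>(u, v)\<in>?P. ?cd u v) = (\<Sum>u\<in>V. real (wt u))"
    by (subst sum.Sigma[symmetric]) (auto simp: wt_def)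
  have "V \<noteq> {}" using neP by auto
  then have n1: "1 \<le> ?n" by (simp add: Suc_leI card_gt_0_iff)
  \<comment> \<open>The two weights contribute at most 54nT and the codegrees at most 54T, where T
    is the number of triangles. The hypothesis \<open>e\<close> then turns 108cn^2 into 432c|E|,
    which is \<open>216 * c\<close> for each of the 2|E| arcs.\<close>
  have "(\<Sum>(u, v)\<in>?P. real (wt u) + real (wt v) + 2 * ?cd u v)
      = 2 * (\<Sum>u\<in>V. ?d u * real (wt u)) + 2 * (\<Sum>u\<in>V. real (wt u))"
    using sum_arcs_fst[of "\<lambda>u. real (wt u)"] sum_arcs_snd[of "\<lambda>u. real (wt u)"] cd
    by (simp add: case_prod_unfold sum.distrib flip: sum_distrib_left)
  also have "\<dots> \<le> 2 * (?n * (27 * ?T)) + 2 * (27 * ?T)" using dw w by linarith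
  also have "\<dots> \<le> 108 * (?n * ?T)"
    using mult_right_mono[OF n1, of ?T] by simp
  also have "\<dots> \<le> 108 * (?n * (c * ?n))" by (intro mult_left_mono T) auto
  also have "\<dots> = (108 * c) * ?n^2" by (simp add: power2_eq_square)
  also have "\<dots> \<le> (108 * c) * (4 * ?e)"
  proof (intro mult_left_mono e)
    have "0 \<le> c * ?n" using T by (rule order_trans[rotated]) simp
    then show "0 \<le> 108 * c" using \<open>V \<noteq> {}\<close> by (auto simp: zero_le_mult_iff)
  qed
  also have "\<dots> = (\<Sum>(u, v)\<in>?P. 216 * c)" using cardP by simp
  finally have upper: "(\<Sum>(u, v)\<in>?P. real (wt u) + real (wt v) + 2 * ?cd u v)
    \<le> (\<Sum>(u, v)\<in>?P. 216 * c)" .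
  have "\<exists>(u, v)\<in>?P. real (wt u) + real (wt v) + 2 * ?cd u v - 216 * c \<le> ?d u + ?d v - ?n"
  proof (rule ccontr)
    assume "\<not> ?thesis"
    then have "(\<Sum>(u, v)\<in>?P. ?d u + ?d v - ?n)
      < (\<Sum>(u, v)\<in>?P. real (wt u) + real (wt v) + 2 * ?cd u v - 216 * c)"
      by (intro sum_strict_mono finP neP) (auto simp: not_le)
    also have "\<dots> \<le> 0" using upper by (simp add: case_prod_unfold sum_subtractf)
    finally show False using lower by simp
  qed
  then obtain u v where uv: "v \<in> nbhd u"
    and *: "real (wt u) + real (wt v) + 2 * ?cd u v - 216 * c \<le> ?d u + ?d v - ?n" by auto
  have un: "real (card (nbhd u \<union> nbhd v)) = ?d u + ?d v - ?cd u v"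
    using card_Un_Int[of "nbhd u" "nbhd v"] by simp
  have "real (card (nbhd u \<union> nbhd v)) \<le> ?n"
    by (simp add: card_mono nbhd_subset)
  then show ?thesis using that[of u v] uv * un by (simp add: nbhd_iff)
qed

section \<open>Inner edges of a cut, and a cut with few of them\<close>

definition edges_in :: "'a set \<Rightarrow> 'a set set" where
  "edges_in A = {e \<in> E. e \<subseteq> A}"

definition inner_edges :: "'a set \<Rightarrow> 'a set set" where
  "inner_edges A = edges_in A \<union> edges_in (V - A)"

lemma finite_edges_in [simp]: "finite (edges_in A)"
  by (simp add: edges_in_def)

lemma inner_edgeI:
  assumes "{x, y} \<in> E" "x \<in> A \<longleftrightarrow> y \<in> A"
  shows "{x, y} \<in> inner_edges A"
proof -
  have "{x, y} \<subseteq> A \<or> {x, y} \<subseteq> V - A" using assms edgeD(1,2)[OF assms(1)] by blast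
  then show ?thesis using assms(1) by (auto simp: inner_edges_def edges_in_def)
qed

lemma card_inner_edges: "card (inner_edges A) = card (edges_in A) + card (edges_in (V - A))"
  unfolding inner_edges_def
proof (rule card_Un_disjoint)
  have "e \<noteq> {}" if "e \<in> E" for e using that by (rule edgeE) auto
  then show "edges_in A \<inter> edges_in (V - A) = {}" by (auto simp: edges_in_def)
qed auto

text \<open>An edge inside \<open>nbhd u\<close> closes a triangle at \<open>u\<close>, so its
  endpoints form a pair counted by \<open>wt u\<close>.\<close>

lemma card_edges_in_nbhd: "card (edges_in (nbhd u)) \<le> wt u"
proof -
  let ?S = "Sigma (nbhd u) (\<lambda>v. nbhd u \<inter> nbhd v)"
  have fin: "finite ?S" by (intro finite_SigmaI) auto
  have "edges_in (nbhd u) \<subseteq> (\<lambda>(x, y). {x, y}) ` ?S"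
  proof
    fix e assume "e \<in> edges_in (nbhd u)"
    then have e: "e \<in> E" "e \<subseteq> nbhd u" by (auto simp: edges_in_def)
    from e(1) obtain x y where xy: "e = {x, y}" by (rule edgeE)
    then have "(x, y) \<in> ?S" using e by (auto simp: nbhd_iff)
    then show "e \<in> (\<lambda>(x, y). {x, y}) ` ?S" using xy by force
  qed
  then have "card (edges_in (nbhd u)) \<le> card ((\<lambda>(x, y). {x, y}) ` ?S)"
    using fin by (intro card_mono) auto
  also have "\<dots> \<le> card ?S" using fin by (rule card_image_le)
  also have "\<dots> = wt u" by (simp add: wt_def)
  finally show ?thesis .
qed

text \<open>The cut is \<open>nbhd u\<close> against its complement for a good arc (u, v). An edge
  in the complement either lies in \<open>nbhd v\<close>, where few edges exist, or meets the set
  \<open>R\<close> of at most \<open>216 * c\<close> vertices outside both neighbourhoods. Edges of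
  the first kind and those in \<open>nbhd u\<close> number at most \<open>216 * c\<close> together,
  the others at most \<open>216 * c * n\<close>.\<close>

lemma exists_sparse_cut:
  fixes c :: real
  assumes "real (card V) ^ 2 \<le> 4 * real (card E)" and "E \<noteq> {}"
    and "real (card (triangles V E)) \<le> c * real (card V)"
  obtains A where "A \<subseteq> V" "real (card (inner_edges A)) \<le> 432 * c * real (card V)"
proof -
  let ?n = "real (card V)"
  obtain u v where uv: "{u, v} \<in> E" and w: "real (wt u) + real (wt v) \<le> 216 * c"
    and un: "?n - 216 * c \<le> real (card (nbhd u \<union> nbhd v))"
    using exists_good_arc[OF assms] .
  define R where "R = V - (nbhd u \<union> nbhd v)"
  have cR: "real (card R) \<le> 216 * c"
    using un nbhd_subset by (simp add: R_def card_Diff_subset card_mono of_nat_diff)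
  have "edges_in (V - nbhd u) \<subseteq> edges_in (nbhd v) \<union> (\<lambda>(x, y). {x, y}) ` (R \<times> V)"
  proof
    fix e assume "e \<in> edges_in (V - nbhd u)"
    then have e: "e \<in> E" "e \<subseteq> V - nbhd u" by (auto simp: edges_in_def)
    show "e \<in> edges_in (nbhd v) \<union> (\<lambda>(x, y). {x, y}) ` (R \<times> V)"
    proof (cases "e \<subseteq> nbhd v")
      case True then show ?thesis using e by (auto simp: edges_in_def)
    next
      case False
      then obtain x where x: "x \<in> e" "x \<in> R" using e by (auto simp: R_def)
      from e(1) obtain p q where "e = {p, q}" "p \<in> V" "q \<in> V" by (rule edgeE)
      then obtain y where "e = {x, y}" "y \<in> V" using x by (auto simp: insert_commute)
      then show ?thesis using x by auto
    qed
  qed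
  then have "card (edges_in (V - nbhd u))
      \<le> card (edges_in (nbhd v) \<union> (\<lambda>(x, y). {x, y}) ` (R \<times> V))"
    by (intro card_mono) (auto simp: R_def)
  also have "\<dots> \<le> card (edges_in (nbhd v)) + card ((\<lambda>(x, y). {x, y}) ` (R \<times> V))"
    by (rule card_Un_le)
  also have "\<dots> \<le> wt v + card (R \<times> V)"
    by (intro add_mono card_edges_in_nbhd card_image_le) (auto simp: R_def)
  finally have "card (inner_edges (nbhd u)) \<le> wt u + wt v + card R * card V"
    using card_edges_in_nbhd[of u] by (simp add: card_inner_edges card_cartesian_product)
  then have "real (card (inner_edges (nbhd u))) \<le> real (wt u + wt v + card R * card V)"
    by (simp only: of_nat_le_iff)
  also have "\<dots> \<le> 216 * c + 216 * c * ?n"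
    using w mult_right_mono[OF cR, of ?n] by simp
  also have "\<dots> \<le> 432 * c * ?n"
  proof -
    have "0 < card V" using edgeD(1)[OF uv] by (auto simp: card_gt_0_iff)
    then have "1 \<le> ?n" by linarith
    moreover have "0 \<le> 216 * c" using cR by (rule order_trans[rotated]) simp
    ultimately have "216 * c * 1 \<le> 216 * c * ?n" by (rule mult_left_mono)
    then show ?thesis by simp
  qed
  finally show ?thesis using that nbhd_subset by blast
qed

lemma inner_edges_commute: "A \<subseteq> V \<Longrightarrow> inner_edges (V - A) = inner_edges A"
  by (simp add: inner_edges_def Un_commute double_diff)

section \<open>Counting triangles and edges across a cut\<close>

definition deg_in :: "'a set \<Rightarrow> 'a \<Rightarrow> nat" where
  "deg_in A x = card {e \<in> edges_in A. x \<in> e}"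

text \<open>Pairs are ordered, so that a missing \<open>(x, y)\<close> can be charged separately to
  the inner edges at \<open>x\<close> on one side and at \<open>y\<close> on the other.\<close>

definition missing :: "'a set \<Rightarrow> 'a set \<Rightarrow> ('a \<times> 'a) set" where
  "missing A B = {(x, y) \<in> A \<times> B. {x, y} \<notin> E}"

lemma finite_missing:
  assumes "finite A" "finite B"
  shows "finite (missing A B)"
  using assms by (auto simp: missing_def intro: finite_subset[of _ "A \<times> B"])

lemma sum_missing_swap: "(\<Sum>(x, y)\<in>missing A B. f x y) = (\<Sum>(y, x)\<in>missing B A. f x y)"
  by (rule sum.reindex_bij_witness[where i = prod.swap and j = prod.swap])
    (auto simp: missing_def insert_commute)

lemma card_missing_swap: "card (missing A B) = card (missing B A)"
  using sum_missing_swap[of "\<lambda>_ _. 1 :: nat" A B] by simp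

text \<open>\<open>deg_in\<close> counts edges, which suits double counting and matchings; degree
  arguments at a single vertex need the neighbour form.\<close>

lemma deg_in_eq:
  assumes "x \<in> A"
  shows "deg_in A x = card (nbhd x \<inter> A)"
proof -
  have "{e \<in> edges_in A. x \<in> e} = (\<lambda>y. {x, y}) ` (nbhd x \<inter> A)"
  proof (intro equalityI subsetI)
    fix e assume "e \<in> {e \<in> edges_in A. x \<in> e}"
    then have e: "e \<in> E" "e \<subseteq> A" "x \<in> e" by (auto simp: edges_in_def)
    from e(1) obtain p q where "e = {p, q}" by (rule edgeE)
    then obtain y where "e = {x, y}" using e(3) by (auto simp: insert_commute)
    then show "e \<in> (\<lambda>y. {x, y}) ` (nbhd x \<inter> A)" using e by (auto simp: nbhd_iff)
  qed (use assms in \<open>auto simp: edges_in_def nbhd_iff\<close>)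
  moreover have "inj_on (\<lambda>y. {x, y}) (nbhd x \<inter> A)"
    by (auto simp: inj_on_def doubleton_eq_iff)
  ultimately show ?thesis by (simp add: deg_in_def card_image)
qed

text \<open>An inner edge of \<open>A\<close> and a vertex of \<open>B\<close> either span a
  triangle or involve a missing pair. A missing \<open>(x, y)\<close> spoils only the combinations
  of \<open>y\<close> with the \<open>deg_in A x\<close> inner edges at \<open>x\<close>.\<close>

lemma cross_triangles:
  assumes "A \<subseteq> V" "B \<subseteq> V" "A \<inter> B = {}"
  shows "card (edges_in A) * card B
    \<le> card {T \<in> triangles V E. card (T \<inter> A) = 2} + (\<Sum>(x, y)\<in>missing A B. deg_in A x)"
proof -
  have fin: "finite A" "finite B" using assms(1,2) by (auto intro: finite_subset[OF _ finite_V])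
  define G where "G = {(e, z) \<in> edges_in A \<times> B. \<forall>x\<in>e. {x, z} \<in> E}"
  define L where "L = Sigma (missing A B) (\<lambda>(x, y). {e \<in> edges_in A. x \<in> e})"
  have finL: "finite L" unfolding L_def using finite_missing[OF fin]
    by (intro finite_SigmaI) auto
  have "finite G" using fin by (auto simp: G_def intro: finite_subset[of _ "edges_in A \<times> B"])
  have "edges_in A \<times> B \<subseteq> G \<union> (\<lambda>((x, y), e). (e, y)) ` L"
  proof clarify
    fix e z assume e: "e \<in> edges_in A" and z: "z \<in> B" and "(e, z) \<notin> (\<lambda>((x, y), e). (e, y)) ` L"
    have "{x, z} \<in> E" if "x \<in> e" for x
    proof (rule ccontr)
      assume "{x, z} \<notin> E"
      then have "((x, z), e) \<in> L"
        using that e z by (auto simp: L_def missing_def edges_in_def)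
      then show False using \<open>(e, z) \<notin> _\<close> by force
    qed
    then show "(e, z) \<in> G" using e z by (auto simp: G_def)
  qed
  then have "card (edges_in A \<times> B) \<le> card (G \<union> (\<lambda>((x, y), e). (e, y)) ` L)"
    using \<open>finite G\<close> finL by (intro card_mono) auto
  also have "\<dots> \<le> card G + card ((\<lambda>((x, y), e). (e, y)) ` L)" by (rule card_Un_le)
  also have "\<dots> \<le> card G + card L" using finL by (intro add_left_mono card_image_le)
  also have "card L = (\<Sum>(x, y)\<in>missing A B. deg_in A x)"
    unfolding L_def using finite_missing[OF fin] by (simp add: case_prod_unfold deg_in_def)
  also have "card G \<le> card {T \<in> triangles V E. card (T \<inter> A) = 2}"
  proof (rule card_inj_on_le)
    \<comment> \<open>The traces on \<open>A\<close> and on \<open>B\<close> recover the edge and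
      the vertex, so different combinations give different triangles.\<close>
    have split: "(e \<union> {z}) \<inter> A = e" "(e \<union> {z}) \<inter> B = {z}" if "(e, z) \<in> G" for e z
      using that assms by (auto simp: G_def edges_in_def)
    show "inj_on (\<lambda>(e, z). e \<union> {z}) G"
    proof (rule inj_onI, clarify)
      fix e z e' z' assume "(e, z) \<in> G" "(e', z') \<in> G" "e \<union> {z} = e' \<union> {z'}"
      then show "e = e' \<and> z = z'" using split by (metis singleton_inject)
    qed
    show "(\<lambda>(e, z). e \<union> {z}) ` G \<subseteq> {T \<in> triangles V E. card (T \<inter> A) = 2}"
    proof clarify
      fix e z assume g: "(e, z) \<in> G"
      then have "e \<in> E" by (auto simp: G_def edges_in_def)
      then obtain x y where xy: "e = {x, y}" "x \<noteq> y" by (rule edgeE)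
      have "{x, y, z} \<in> triangles V E"
        by (rule triangleI) (use g xy \<open>e \<in> E\<close> in \<open>auto simp: G_def\<close>)
      moreover have "card ((e \<union> {z}) \<inter> A) = 2" using split(1)[OF g] xy by simp
      ultimately show "e \<union> {z} \<in> triangles V E \<and> card ((e \<union> {z}) \<inter> A) = 2"
        using xy by (simp add: insert_commute)
    qed
  qed simp
  finally show ?thesis by (simp add: card_cartesian_product)
qed

text \<open>The previous bound is applied to both sides. No triangle is counted twice, since its
  three vertices cannot be split as two and two.\<close>

lemma triangle_count:
  assumes "A \<subseteq> V"
  shows "card (edges_in A) * card (V - A) + card (edges_in (V - A)) * card A
    \<le> card (triangles V E) + (\<Sum>(x, y)\<in>missing A (V - A). deg_in A x + deg_in (V - A) y)"
proof -
  let ?B = "V - A"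
  let ?TA = "{T \<in> triangles V E. card (T \<inter> A) = 2}"
  let ?TB = "{T \<in> triangles V E. card (T \<inter> ?B) = 2}"
  have disj: "?TA \<inter> ?TB = {}"
  proof -
    have "card (T \<inter> A) + card (T \<inter> ?B) = 3" if "T \<in> triangles V E" for T
    proof -
      have T: "card T = 3" "T \<subseteq> V" "finite T" using that by (auto simp: triangles_def nsets_def)
      have "T = (T \<inter> A) \<union> (T \<inter> ?B)" using T by auto
      then show ?thesis using T(1,3) card_Un_disjoint[of "T \<inter> A" "T \<inter> ?B"] by auto
    qed
    then show ?thesis by fastforce
  qed
  have "card ?TA + card ?TB = card (?TA \<union> ?TB)"
    using disj by (intro card_Un_disjoint[symmetric]) auto
  also have "\<dots> \<le> card (triangles V E)" by (intro card_mono) auto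
  finally have TT: "card ?TA + card ?TB \<le> card (triangles V E)" .
  have "(\<Sum>(x, y)\<in>missing A ?B. deg_in A x + deg_in ?B y)
      = (\<Sum>(x, y)\<in>missing A ?B. deg_in A x) + (\<Sum>(x, y)\<in>missing ?B A. deg_in ?B x)"
    using sum_missing_swap[of "\<lambda>x y. deg_in ?B y" A ?B]
    by (simp add: case_prod_unfold sum.distrib)
  moreover have "card (edges_in A) * card ?B \<le> card ?TA + (\<Sum>(x, y)\<in>missing A ?B. deg_in A x)"
    using assms by (intro cross_triangles) auto
  moreover have "card (edges_in ?B) * card A \<le> card ?TB + (\<Sum>(x, y)\<in>missing ?B A. deg_in ?B x)"
    using assms by (intro cross_triangles) auto
  ultimately show ?thesis using TT by linarith
qed

text \<open>An edge is either inner or a present cross pair. Adding the missing pairs on the left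
  avoids subtraction of natural numbers.\<close>

lemma edge_count:
  assumes "A \<subseteq> V"
  shows "card E + card (missing A (V - A)) = card (inner_edges A) + card A * card (V - A)"
proof -
  let ?B = "V - A"
  define C where "C = {(x, y) \<in> A \<times> ?B. {x, y} \<in> E}"
  have fin: "finite A" using assms by (auto intro: finite_subset[OF _ finite_V])
  have finC: "finite C" using fin by (auto simp: C_def intro: finite_subset[of _ "A \<times> ?B"])
  have "A \<times> ?B = C \<union> missing A ?B" by (auto simp: C_def missing_def)
  moreover have "C \<inter> missing A ?B = {}" by (auto simp: C_def missing_def)
  ultimately have AB: "card A * card ?B = card C + card (missing A ?B)"
    using card_Un_disjoint[OF finC, of "missing A ?B"] fin
    by (simp add: finite_missing flip: card_cartesian_product)
  have "inj_on (\<lambda>(x, y). {x, y}) C"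
    by (auto simp: C_def inj_on_def doubleton_eq_iff)
  then have cC: "card ((\<lambda>(x, y). {x, y}) ` C) = card C" by (rule card_image)
  have "E = inner_edges A \<union> (\<lambda>(x, y). {x, y}) ` C"
  proof (intro equalityI subsetI)
    fix e assume "e \<in> E"
    then obtain x y where xy: "e = {x, y}" "x \<in> V" "y \<in> V" by (rule edgeE)
    show "e \<in> inner_edges A \<union> (\<lambda>(x, y). {x, y}) ` C"
    proof (cases "x \<in> A \<longleftrightarrow> y \<in> A")
      case True
      then show ?thesis using xy \<open>e \<in> E\<close> by (auto simp: inner_edges_def edges_in_def)
    next
      case False
      then have "(x, y) \<in> C \<or> (y, x) \<in> C"
        using xy \<open>e \<in> E\<close> by (auto simp: C_def insert_commute)
      then show ?thesis using xy by (force simp: insert_commute)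
    qed
  qed (auto simp: inner_edges_def edges_in_def C_def)
  moreover have "inner_edges A \<inter> (\<lambda>(x, y). {x, y}) ` C = {}"
    by (auto simp: inner_edges_def edges_in_def C_def)
  ultimately have "card E = card (inner_edges A) + card C"
    using cC finC card_Un_disjoint[of "inner_edges A" "(\<lambda>(x, y). {x, y}) ` C"]
    by (simp add: inner_edges_def)
  then show ?thesis using AB by simp
qed

text \<open>Moving \<open>x\<close> to the other side removes its inner edges and turns its cross
  edges into inner ones; by \<open>min\<close> this is no gain.\<close>

lemma deg_in_le_cross:
  assumes "A \<subseteq> V" "x \<in> A"
    and min: "card (inner_edges A) \<le> card (inner_edges (A - {x}))"
  shows "deg_in A x \<le> card (nbhd x \<inter> (V - A))"
proof -
  let ?I = "{e \<in> edges_in A. x \<in> e}"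
  let ?N = "(\<lambda>y. {x, y}) ` (nbhd x \<inter> (V - A))"
  have I: "?I \<subseteq> inner_edges A" by (auto simp: inner_edges_def)
  have "inner_edges (A - {x}) \<subseteq> (inner_edges A - ?I) \<union> ?N"
  proof
    fix e assume "e \<in> inner_edges (A - {x})"
    then have e: "e \<in> E" "e \<subseteq> A - {x} \<or> e \<subseteq> V - (A - {x})"
      by (auto simp: inner_edges_def edges_in_def)
    show "e \<in> (inner_edges A - ?I) \<union> ?N"
    proof (cases "x \<in> e")
      case True
      from e(1) obtain p q where "e = {p, q}" "p \<noteq> q" by (rule edgeE)
      then obtain y where "e = {x, y}" "y \<noteq> x" using True by (auto simp: insert_commute)
      then show ?thesis using e by (auto simp: nbhd_iff)
    next
      case False
      then show ?thesis using e by (auto simp: inner_edges_def edges_in_def)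
    qed
  qed
  then have "card (inner_edges (A - {x})) \<le> card ((inner_edges A - ?I) \<union> ?N)"
    by (intro card_mono) (auto simp: inner_edges_def)
  also have "\<dots> \<le> card (inner_edges A - ?I) + card ?N" by (rule card_Un_le)
  also have "\<dots> \<le> card (inner_edges A - ?I) + card (nbhd x \<inter> (V - A))"
    by (intro add_left_mono card_image_le) simp
  also have "card (inner_edges A - ?I) = card (inner_edges A) - card ?I"
    using I by (intro card_Diff_subset) auto
  finally have "card (inner_edges A)
    \<le> card (inner_edges A) - card ?I + card (nbhd x \<inter> (V - A))" using min by linarith
  moreover have "card ?I \<le> card (inner_edges A)"
    using I by (intro card_mono) (auto simp: inner_edges_def)
  ultimately show ?thesis by (simp add: deg_in_def)
qed

text \<open>By the previous lemma \<open>x\<close> has at least \<open>deg_in A x\<close> neighbours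
  on each side. A pair of neighbours from different sides either forms a triangle with
  \<open>x\<close> or is missing.\<close>

lemma deg_in_square_le:
  assumes "A \<subseteq> V" "x \<in> A"
    and min: "card (inner_edges A) \<le> card (inner_edges (A - {x}))"
  shows "(deg_in A x)\<^sup>2 \<le> card (triangles V E) + card (missing A (V - A))"
proof -
  let ?B = "V - A"
  let ?P = "(nbhd x \<inter> A) \<times> (nbhd x \<inter> ?B)"
  define G where "G = {(y, z) \<in> ?P. {y, z} \<in> E}"
  have fin: "finite G" "finite (missing A ?B)"
    using assms(1) finite_subset[OF assms(1)]
    by (auto simp: G_def finite_missing intro: finite_subset[of _ ?P])
  have "(deg_in A x)\<^sup>2 \<le> card (nbhd x \<inter> A) * card (nbhd x \<inter> ?B)"
    using deg_in_le_cross[OF assms] deg_in_eq[OF assms(2)]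
    by (simp add: power2_eq_square mult_left_mono)
  also have "\<dots> = card ?P" by (simp add: card_cartesian_product)
  also have "\<dots> \<le> card (G \<union> missing A ?B)"
    using fin by (intro card_mono) (auto simp: G_def missing_def)
  also have "\<dots> \<le> card G + card (missing A ?B)" by (rule card_Un_le)
  also have "card G \<le> card (triangles V E)"
  proof (rule card_inj_on_le)
    have split: "{x, y, z} \<inter> A - {x} = {y}" "{x, y, z} \<inter> ?B = {z}" if "(y, z) \<in> G" for y z
      using that assms(2) edgeD(3) by (auto simp: G_def nbhd_iff)
    show "inj_on (\<lambda>(y, z). {x, y, z}) G"
    proof (rule inj_onI, clarify)
      fix y z y' z' assume "(y, z) \<in> G" "(y', z') \<in> G" "{x, y, z} = {x, y', z'}"
      then show "y = y' \<and> z = z'" using split by (metis singleton_inject)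
    qed
    show "(\<lambda>(y, z). {x, y, z}) ` G \<subseteq> triangles V E"
      by (auto simp: G_def nbhd_iff intro!: triangleI)
  qed simp
  finally show ?thesis by simp
qed

section \<open>Covering number and inner edges\<close>

lemma tau3_le_card:
  assumes "triangle_covering_set V E X"
  shows "tau3 V E \<le> card X"
proof -
  have "finite {X. triangle_covering_set V E X}"
    by (rule finite_subset[of _ "Pow V"]) (auto simp: triangle_covering_set_def)
  then show ?thesis unfolding tau3_def using assms by (intro Min_le) auto
qed

text \<open>Two vertices of any triangle lie on the same side, so it contains an inner edge. Hence
  \<open>X\<close> together with one chosen endpoint of each edge in \<open>F\<close> covers all
  triangles.\<close>

lemma tau3_le_inner:
  assumes A: "A \<subseteq> V" and X: "X \<subseteq> V" and F: "F \<subseteq> inner_edges A"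
    and cover: "\<And>e. e \<in> inner_edges A - F \<Longrightarrow> e \<inter> X \<noteq> {}"
  shows "tau3 V E \<le> card X + card F"
proof -
  define p where "p e = (SOME x. x \<in> e)" for e :: "'a set"
  have FE: "F \<subseteq> E" using F by (auto simp: inner_edges_def edges_in_def)
  then have finF: "finite F" using finite_subset finite_E by blast
  have p: "p e \<in> e" if "e \<in> F" for e
  proof -
    from that FE have "e \<in> E" by auto
    then have "\<exists>x. x \<in> e" by (rule edgeE) auto
    then show ?thesis unfolding p_def by (rule someI_ex)
  qed
  have "triangle_covering_set V E (X \<union> p ` F)"
    unfolding triangle_covering_set_def
  proof (intro conjI ballI)
    show "X \<union> p ` F \<subseteq> V" using X p FE edge_subset by blast
    fix T assume "T \<in> triangles V E"
    then obtain x y z where T: "T = {x, y, z}" and E: "{x, y} \<in> E" "{x, z} \<in> E" "{y, z} \<in> E"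
      by (rule triangleE)
    have "\<exists>e. e \<subseteq> T \<and> e \<in> inner_edges A"
    proof (cases "x \<in> A \<longleftrightarrow> y \<in> A")
      case True
      then have "{x, y} \<in> inner_edges A" by (rule inner_edgeI[OF E(1)])
      moreover have "{x, y} \<subseteq> T" unfolding T by simp
      ultimately show ?thesis by (intro exI[of _ "{x, y}"] conjI)
    next
      case False
      then have "{x, z} \<in> inner_edges A \<or> {y, z} \<in> inner_edges A"
        using inner_edgeI[OF E(2)] inner_edgeI[OF E(3)] by blast
      moreover have "{x, z} \<subseteq> T" "{y, z} \<subseteq> T" unfolding T by simp_all
      ultimately show ?thesis by metis
    qed
    then obtain e where e: "e \<subseteq> T" "e \<in> inner_edges A" by blast
    show "(X \<union> p ` F) \<inter> T \<noteq> {}"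
    proof (cases "e \<in> F")
      case True
      then show ?thesis using p[OF True] e by blast
    next
      case False
      then show ?thesis using cover[of e] e by blast
    qed
  qed
  then have "tau3 V E \<le> card (X \<union> p ` F)" by (rule tau3_le_card)
  also have "\<dots> \<le> card X + card (p ` F)" by (rule card_Un_le)
  also have "\<dots> \<le> card X + card F" using finF by (intro add_left_mono card_image_le)
  finally show ?thesis .
qed

lemma tau3_le_card_inner: "A \<subseteq> V \<Longrightarrow> tau3 V E \<le> card (inner_edges A)"
  using tau3_le_inner[of A "{}" "inner_edges A"] by simp

text \<open>A common vertex of two inner edges would cover both, giving a triangle covering set
  smaller than the number of inner edges.\<close>

lemma inner_matching:
  assumes A: "A \<subseteq> V" and tau: "card (inner_edges A) \<le> tau3 V E"
    and e: "e \<in> inner_edges A" "e' \<in> inner_edges A" "e \<noteq> e'"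
  shows "e \<inter> e' = {}"
proof (rule ccontr)
  assume "e \<inter> e' \<noteq> {}"
  then obtain x where x: "x \<in> e" "x \<in> e'" by blast
  have fin: "finite (inner_edges A)" by (simp add: inner_edges_def)
  have "e \<subseteq> V" using A e(1) by (auto simp: inner_edges_def edges_in_def)
  then have "tau3 V E \<le> card {x} + card (inner_edges A - {e, e'})"
    using A x by (intro tau3_le_inner[of A]) auto
  also have "card (inner_edges A - {e, e'}) = card (inner_edges A) - 2"
    using e by (subst card_Diff_subset) auto
  also have "card {e, e'} \<le> card (inner_edges A)"
    using e fin by (intro card_mono) auto
  then have "card {x} + (card (inner_edges A) - 2) < card (inner_edges A)"
    using e(3) by simp
  finally show False using tau by simp
qed

lemma deg_in_le_1:
  assumes A: "A \<subseteq> V" and tau: "card (inner_edges A) \<le> tau3 V E"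
  shows "deg_in A x \<le> 1"
  unfolding deg_in_def
proof (rule card_le_Suc0_iff_eq[THEN iffD2, unfolded One_nat_def[symmetric]])
  have "e = e'" if "e \<in> edges_in A" "e' \<in> edges_in A" "x \<in> e" "x \<in> e'" for e e'
  proof (rule ccontr)
    assume "e \<noteq> e'"
    then have "e \<inter> e' = {}"
      using that by (intro inner_matching[OF A tau]) (auto simp: inner_edges_def)
    then show False using that by blast
  qed
  then show "\<forall>e\<in>{e \<in> edges_in A. x \<in> e}. \<forall>e'\<in>{e \<in> edges_in A. x \<in> e}. e = e'"
    by blast
qed simp

section \<open>From a minimum cut to at most \<open>s\<close> inner edges, and the exact
  count\<close>

lemma exists_cut_few_inner:
  fixes s :: nat
  assumes e: "real (card V) ^ 2 \<le> 4 * real (card E)" and "E \<noteq> {}"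
    and T: "2 * real (card (triangles V E)) \<le> real s * real (card V)"
    and large: "15588 * (real s + 1)^2 * real s < real (card V)"
  obtains A where "A \<subseteq> V" "card (V - A) \<le> card A" "card (inner_edges A) \<le> s"
proof -
  let ?n = "real (card V)"
  have "2 * real (card (triangles V E)) \<le> 2 * (real s * ?n)" using T by simp
  then obtain A\<^sub>0 where A0: "A\<^sub>0 \<subseteq> V" "real (card (inner_edges A\<^sub>0)) \<le> 432 * real s * ?n"
    using exists_sparse_cut[OF e \<open>E \<noteq> {}\<close>, of "real s"] by auto
  \<comment> \<open>The sparse cut serves as an upper bound for the minimum; global minimality
    ensures that moving a vertex from either side never helps.\<close>
  obtain A\<^sub>1 where A1: "A\<^sub>1 \<subseteq> V"
    "\<And>A'. A' \<subseteq> V \<Longrightarrow> card (inner_edges A\<^sub>1) \<le> card (inner_edges A')"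
    using ex_has_least_nat[of "\<lambda>A. A \<subseteq> V" A\<^sub>0 "\<lambda>A. card (inner_edges A)"] A0(1) by blast
  define A where "A = (if card (V - A\<^sub>1) \<le> card A\<^sub>1 then A\<^sub>1 else V - A\<^sub>1)"
  define B where "B = V - A"
  have AV: "A \<subseteq> V" "B \<subseteq> V" "V - B = A" using A1(1) by (auto simp: A_def B_def)
  have BA: "card B \<le> card A" using A1(1) by (auto simp: A_def B_def double_diff)
  have "inner_edges A = inner_edges A\<^sub>1"
    using inner_edges_commute[OF A1(1)] by (simp add: A_def)
  then have minA: "card (inner_edges A) \<le> card (inner_edges A')" if "A' \<subseteq> V" for A'
    using A1(2)[OF that] by simp
  have "inner_edges B = inner_edges A" unfolding B_def by (rule inner_edges_commute[OF AV(1)])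
  then have minB: "card (inner_edges B) \<le> card (inner_edges A')" if "A' \<subseteq> V" for A'
    using minA[OF that] by simp
  \<comment> \<open>In \<open>h\<close>, 433 = 432 + 1: at most \<open>k\<close>, hence at most
    432sn, pairs are missing, and there are at most sn triangles. Their sum bounds the square of
    every inner degree, so \<open>h\<close> bounds the inner degrees.\<close>
  define k a b M t h where "k = real (card (inner_edges A))" and "a = real (card A)"
    and "b = real (card B)" and "M = real (card (missing A B))"
    and "t = real (card (triangles V E))" and "h = sqrt (433 * real s * ?n)"
  define r where "r = real s * ?n"
  have r: "0 \<le> r" by (simp add: r_def)
  have h: "0 \<le> h" "h^2 = 433 * r" by (auto simp: h_def r_def)
  have k: "0 \<le> k" "k \<le> 432 * r" using minA[OF A0(1)] A0(2) by (auto simp: k_def r_def)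
  have "card V = card A + card B"
    using AV finite_subset[OF AV(1)] card_Diff_subset[of A V] card_mono[of V A] by (simp add: B_def)
  then have n: "?n = a + b" by (simp add: a_def b_def)
  have ec: "real (card E) + M = k + a * b"
    using edge_count[OF AV(1), folded B_def] unfolding k_def a_def b_def M_def
    by (metis of_nat_add of_nat_mult)
  \<comment> \<open>Combined with the edge count, this identity yields both that at most
    \<open>k\<close> pairs are missing and that the parts differ by at most 2 sqrt(k), hence by at
    most \<open>2 * h\<close>.\<close>
  have "(a - b)^2 = ?n^2 - 4 * (a * b)" by (simp add: n power2_eq_square algebra_simps)
  then have ab: "(a - b)^2 + 4 * M \<le> 4 * k" using ec e by linarith
  then have Mk: "M \<le> k" by (smt (verit) zero_le_power2)
  have t: "2 * t \<le> r" using T by (simp add: t_def r_def)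
  have "(a - b)^2 \<le> 4 * k" using ab by (simp add: M_def)
  also have "4 * k \<le> (2 * h)^2" using k(2) h(2) r by (simp add: power_mult_distrib)
  finally have "(a - b)^2 \<le> (2 * h)^2" .
  then have "a - b \<le> 2 * h" by (rule power2_le_imp_le) (simp add: h(1))
  then have b: "?n - 2 * h \<le> 2 * b" using n by linarith
  have tM: "t + M \<le> h^2" using t Mk k(2) h(2) r by linarith
  have dA: "real (deg_in A x) \<le> h" if "x \<in> A" for x
  proof -
    have "(deg_in A x)\<^sup>2 \<le> card (triangles V E) + card (missing A B)"
      using deg_in_square_le[OF AV(1) that minA] AV(1) by (simp add: B_def subset_iff)
    then have "real (deg_in A x) ^ 2 \<le> t + M"
      unfolding t_def M_def by (metis of_nat_add of_nat_le_iff of_nat_power)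
    then have "real (deg_in A x) ^ 2 \<le> h^2" using tM by linarith
    then show ?thesis using h(1) by (rule power2_le_imp_le)
  qed
  have dB: "real (deg_in B x) \<le> h" if "x \<in> B" for x
  proof -
    have "(deg_in B x)\<^sup>2 \<le> card (triangles V E) + card (missing A B)"
      using deg_in_square_le[OF AV(2) that minB] AV(2) card_missing_swap[of A B]
      by (simp add: AV(3) subset_iff)
    then have "real (deg_in B x) ^ 2 \<le> t + M"
      unfolding t_def M_def by (metis of_nat_add of_nat_le_iff of_nat_power)
    then have "real (deg_in B x) ^ 2 \<le> h^2" using tM by linarith
    then show ?thesis using h(1) by (rule power2_le_imp_le)
  qed
  have "real (\<Sum>(x, y)\<in>missing A B. deg_in A x + deg_in B y)
      = (\<Sum>p\<in>missing A B. real (deg_in A (fst p)) + real (deg_in B (snd p)))"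
    by (simp add: case_prod_unfold)
  also have "\<dots> \<le> real (card (missing A B)) * (h + h)"
    using dA dB by (intro sum_bounded_above add_mono) (auto simp: missing_def)
  finally have loss: "real (\<Sum>(x, y)\<in>missing A B. deg_in A x + deg_in B y) \<le> M * (2 * h)"
    by (simp add: M_def)
  have "card (inner_edges A) * card B \<le> card (edges_in A) * card B + card (edges_in B) * card A"
    using BA by (simp add: card_inner_edges B_def algebra_simps)
  also have "\<dots> \<le> card (triangles V E) + (\<Sum>(x, y)\<in>missing A B. deg_in A x + deg_in B y)"
    using triangle_count[OF AV(1)] by (simp add: B_def)
  finally have "k * b \<le> t + real (\<Sum>(x, y)\<in>missing A B. deg_in A x + deg_in B y)"
    unfolding k_def b_def t_def by (metis of_nat_add of_nat_le_iff of_nat_mult)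
  also have "\<dots> \<le> t + k * (2 * h)"
    using loss mult_right_mono[OF Mk, of "2 * h"] h(1) by simp
  finally have "k * (2 * b - 4 * h) \<le> r" using t by (simp add: algebra_simps)
  \<comment> \<open>The \<open>6 * h\<close> consists of \<open>4 * h\<close> from the spoiled
    combinations and \<open>2 * h\<close> from the imbalance of the parts.\<close>
  moreover have "k * (?n - 6 * h) \<le> k * (2 * b - 4 * h)"
    using b k(1) by (intro mult_left_mono) auto
  ultimately have main: "k * (?n - 6 * h) \<le> real s * ?n" by (simp add: r_def)
  have n0: "0 < ?n" using large by (rule le_less_trans[rotated]) simp
  \<comment> \<open>Here 15588 = 36 * 433, so \<open>large\<close> says that 6(s + 1)h < n. With
    \<open>s + 1\<close> inner edges, \<open>main\<close> would give (s + 1)(n - 6h) <= sn, that is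
    n <= 6(s + 1)h.\<close>
  have "(6 * (real s + 1) * h)^2 = 36 * (real s + 1)^2 * h^2" by algebra
  also have "\<dots> = (15588 * (real s + 1)^2 * real s) * ?n" by (simp add: h(2) r_def)
  also have "\<dots> < ?n * ?n" using large n0 by (rule mult_strict_right_mono)
  also have "?n * ?n = ?n^2" by (simp only: power2_eq_square)
  finally have small: "6 * (real s + 1) * h < ?n"
    by (rule power2_less_imp_less) simp
  have "card (inner_edges A) \<le> s"
  proof (rule ccontr)
    assume "\<not> ?thesis"
    then have "real s + 1 \<le> k" by (simp add: k_def)
    moreover have "6 * h \<le> 6 * (real s + 1) * h"
      using h(1) by (simp add: algebra_simps)
    then have "0 \<le> ?n - 6 * h" using small by linarith
    ultimately have "(real s + 1) * (?n - 6 * h) \<le> k * (?n - 6 * h)" by (rule mult_right_mono)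
    then show False using main small by (simp add: algebra_simps)
  qed
  then show ?thesis using that AV(1) BA by (simp add: B_def)
qed

text \<open>The inner edges form a matching, so a missing pair spoils at most one combination for
  each side that has inner edges. The first alternative arises when all of them lie on one side, as
  in G2, the second when both sides have some, as in G1.\<close>

lemma triangles_ge_matching:
  fixes s :: nat
  assumes A: "A \<subseteq> V" and BA: "card (V - A) \<le> card A"
    and s: "card (inner_edges A) = s" and tau: "s \<le> tau3 V E"
  defines "M \<equiv> card (missing A (V - A))"
  shows "s * card (V - A) \<le> card (triangles V E) + M
    \<or> (s - 1) * card (V - A) + card A \<le> card (triangles V E) + 2 * M"
proof -
  let ?B = "V - A"
  let ?L = "\<Sum>(x, y)\<in>missing A ?B. deg_in A x + deg_in ?B y"
  define i j where "i = card (edges_in A)" and "j = card (edges_in ?B)"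
  have ij: "s = i + j" using s by (simp add: card_inner_edges i_def j_def)
  have dA: "deg_in A x \<le> 1" for x using deg_in_le_1[OF A] s tau by simp
  have "card (inner_edges ?B) \<le> tau3 V E" using s tau A by (simp add: inner_edges_commute)
  then have dB: "deg_in ?B x \<le> 1" for x by (rule deg_in_le_1[OF Diff_subset])
  have cnt: "i * card ?B + j * card A \<le> card (triangles V E) + ?L"
    using triangle_count[OF A] by (simp add: i_def j_def)
  have bound: "?L \<le> M * c" if "\<And>x y. deg_in A x + deg_in ?B y \<le> c" for c
    unfolding M_def case_prod_unfold using sum_bounded_above[of "missing A ?B" _ c] that by simp
  consider "i = 0" | "j = 0" | "0 < i" "0 < j" by linarith
  then show ?thesis
  proof cases
    case 1
    then have "deg_in A x = 0" for x by (simp add: deg_in_def i_def)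
    then have "?L \<le> M * 1" using dB by (intro bound) simp
    moreover have "s * card ?B \<le> j * card A" using 1 ij BA by simp
    ultimately show ?thesis using cnt 1 by simp
  next
    case 2
    then have "deg_in ?B x = 0" for x by (simp add: deg_in_def j_def)
    then have "?L \<le> M * 1" using dA by (intro bound) simp
    then show ?thesis using cnt 2 ij by simp
  next
    case 3
    have "deg_in A x + deg_in ?B y \<le> 2" for x y using dA[of x] dB[of y] by linarith
    then have "?L \<le> M * 2" by (rule bound)
    moreover obtain j' where j': "j = Suc j'" using 3 by (cases j) auto
    \<comment> \<open>One inner edge of \<open>?B\<close> keeps the factor \<open>card A\<close>;
      for the others it is lowered to \<open>card ?B\<close>.\<close>
    have "(s - 1) * card ?B + card A \<le> i * card ?B + j * card A"
      using BA by (simp add: ij j' add_mult_distrib)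
    ultimately show ?thesis using cnt by linarith
  qed
qed

end

section \<open>Arithmetic of the minima and of the part sizes\<close>

lemma finite_I_set: "finite (I_set s t n)"
proof (rule finite_subset)
  show "I_set s t n \<subseteq> {..s}"
  proof
    fix a assume "a \<in> I_set s t n"
    then have "(int a)\<^sup>2 + of_bool (odd n) * int a + int t \<le> int s"
      by (simp add: I_set_def alpha_def)
    moreover have "0 \<le> of_bool (odd n) * int a" by simp
    moreover have "int a \<le> (int a)\<^sup>2" by (cases "a = 0") (auto simp: power2_eq_square)
    ultimately have "int a \<le> int s" by linarith
    then show "a \<in> {..s}" by simp
  qed
qed simp

lemma T3_G1_le:
  assumes "a \<in> I_set s t n"
  shows "T3_G1 s t n \<le> (int s - 1) * (\<lfloor>real n / 2\<rfloor> - int a) + (\<lceil>real n / 2\<rceil> + int a)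
    - 2 * alpha s t n a"
  unfolding T3_G1_def using assms by (intro Min_le finite_imageI finite_I_set) auto

lemma T3_G2_le:
  assumes "a \<in> I_set s t n"
  shows "T3_G2 s t n \<le> int s * (\<lfloor>real n / 2\<rfloor> - int a) - alpha s t n a"
  unfolding T3_G2_def using assms by (intro Min_le finite_imageI finite_I_set) auto

text \<open>The witness is the excess of the larger part over the rounded-up half. The product of
  the parts then falls short of its maximum by a^2 or a^2 + a according to parity, which is the
  amount subtracted in \<open>alpha\<close>.\<close>

lemma balanced_parts:
  fixes n p q :: nat
  assumes "p + q = n" "q \<le> p"
  obtains a :: nat where "int p = \<lceil>real n / 2\<rceil> + int a" "int q = \<lfloor>real n / 2\<rfloor> - int a"
    "int p * int q = \<lfloor>(real n)\<^sup>2 / 4\<rfloor> - (int a)\<^sup>2 - of_bool (odd n) * int a"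
proof (cases "even n")
  case True
  then obtain m where m: "n = 2 * m" by (elim evenE)
  define d where "d = p - m"
  have pq: "int p = int m + int d" "int q = int m - int d" using assms m by (auto simp: d_def)
  have "\<lfloor>(real n)\<^sup>2 / 4\<rfloor> = \<lfloor>real_of_int ((int m)\<^sup>2)\<rfloor>" by (simp add: m)
  then have "\<lfloor>(real n)\<^sup>2 / 4\<rfloor> = (int m)\<^sup>2" by (simp only: floor_of_int)
  moreover have "int p * int q = (int m)\<^sup>2 - (int d)\<^sup>2"
    unfolding pq by (simp add: power2_eq_square algebra_simps)
  ultimately show ?thesis using pq True by (intro that[of d]) (simp_all add: m)
next
  case False
  then obtain m where m: "n = 2 * m + 1" by (elim oddE)
  define d where "d = p - Suc m"
  have pq: "int p = int m + 1 + int d" "int q = int m - int d"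
    using assms m by (auto simp: d_def)
  have "\<lfloor>(real n)\<^sup>2 / 4\<rfloor> = (int m)\<^sup>2 + int m"
    by (rule floor_unique) (auto simp: m power2_eq_square field_simps)
  moreover have "\<lfloor>real n / 2\<rfloor> = int m" by (rule floor_unique) (auto simp: m)
  moreover have "\<lceil>real n / 2\<rceil> = int m + 1" by (rule ceiling_unique) (auto simp: m)
  moreover have "int p * int q = (int m)\<^sup>2 + int m - (int d)\<^sup>2 - int d"
    unfolding pq by (simp add: power2_eq_square algebra_simps)
  ultimately show ?thesis using pq False by (intro that[of d]) simp_all
qed

section \<open>Comparison with the two constructions\<close>

theorem theorem1p2:
  fixes s t :: nat
  assumes "0 < t" and "t < s"
  shows "\<exists>n0::nat. \<forall>n\<ge>n0. \<forall>(V :: 'a set) (E :: 'a set set).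
           finite_simple_graph V E \<longrightarrow> card V = n \<longrightarrow>
           int (card E) = \<lfloor>(real n)\<^sup>2 / 4\<rfloor> + int t \<longrightarrow>
           tau3 V E \<ge> s \<longrightarrow>
           int (card (triangles V E)) \<ge> min (T3_G1 s t n) (T3_G2 s t n)"
\<comment> \<open>The threshold is that of \<open>exists_cut_few_inner\<close>; the added 1 makes
  the inequality strict and \<open>n\<close> positive.\<close>
proof (intro exI[of _ "15588 * (s + 1)^2 * s + 1"] allI impI)
  fix n :: nat and V :: "'a set" and E :: "'a set set"
  assume n: "15588 * (s + 1)^2 * s + 1 \<le> n" and graph: "finite_simple_graph V E"
    and V: "card V = n" and E: "int (card E) = \<lfloor>(real n)\<^sup>2 / 4\<rfloor> + int t"
    and tau: "s \<le> tau3 V E"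
  interpret simple_graph V E by unfold_locales (rule graph)
  show "min (T3_G1 s t n) (T3_G2 s t n) \<le> int (card (triangles V E))"
  proof (rule ccontr)
    assume "\<not> ?thesis"
    then have few: "int (card (triangles V E)) < T3_G1 s t n"
      "int (card (triangles V E)) < T3_G2 s t n" by auto
    \<comment> \<open>The value of G2 at a = 0 shows that a counterexample has at most sn/2
      triangles.\<close>
    have "0 \<in> I_set s t n" using \<open>t < s\<close> by (simp add: I_set_def alpha_def)
    from T3_G2_le[OF this] few(2) have "int (card (triangles V E)) \<le> int s * \<lfloor>real n / 2\<rfloor>"
      using \<open>t < s\<close> by (simp add: alpha_def)
    then have "real (card (triangles V E)) \<le> real s * of_int \<lfloor>real n / 2\<rfloor>"
      by (metis of_int_le_iff of_int_mult of_int_of_nat_eq)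
    also have "\<dots> \<le> real s * (real n / 2)" by (intro mult_left_mono of_int_floor_le) simp
    finally have T: "2 * real (card (triangles V E)) \<le> real s * real (card V)" by (simp add: V)
    \<comment> \<open>Since \<open>t\<close> is at least 1, it makes up for the rounding of
      n^2/4.\<close>
    have "(real n)\<^sup>2 / 4 \<le> of_int (\<lfloor>(real n)\<^sup>2 / 4\<rfloor> + 1)" by linarith
    also have "\<dots> \<le> of_int (int (card E))" using E \<open>0 < t\<close> by (simp only: of_int_le_iff)
    finally have e: "real (card V) ^ 2 \<le> 4 * real (card E)" by (simp add: V)
    have "15588 * (s + 1)^2 * s < card V" using n V by simp
    then have "real (15588 * (s + 1)^2 * s) < real (card V)" by (simp only: of_nat_less_iff)
    then have large: "15588 * (real s + 1)^2 * real s < real (card V)" by (simp add: algebra_simps)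
    have "E \<noteq> {}"
    proof
      assume "E = {}"
      then show False using e n V by simp
    qed
    then obtain A where A: "A \<subseteq> V" "card (V - A) \<le> card A" "card (inner_edges A) \<le> s"
      using exists_cut_few_inner[OF e _ T large] by blast
    have inner: "card (inner_edges A) = s"
      using A(3) tau3_le_card_inner[OF A(1)] tau by linarith
    have "card A + card (V - A) = n"
      using A(1) V finite_subset[OF A(1)] card_mono[OF finite_V A(1)]
      by (simp add: card_Diff_subset)
    then obtain a where a: "int (card A) = \<lceil>real n / 2\<rceil> + int a"
      "int (card (V - A)) = \<lfloor>real n / 2\<rfloor> - int a"
      "int (card A) * int (card (V - A))
        = \<lfloor>(real n)\<^sup>2 / 4\<rfloor> - (int a)\<^sup>2 - of_bool (odd n) * int a"
      using A(2) by (rule balanced_parts)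
    have "int (card E) + int (card (missing A (V - A)))
        = int s + int (card A) * int (card (V - A))"
      using edge_count[OF A(1)] inner by (metis of_nat_add of_nat_mult)
    \<comment> \<open>With exactly \<open>s\<close> inner edges the number of missing pairs is
      forced to be \<open>alpha s t n a\<close>. Being a cardinality it is nonnegative, so
      \<open>a\<close> is admissible in both minima.\<close>
    then have M: "alpha s t n a = int (card (missing A (V - A)))"
      using E a(3) by (simp add: alpha_def)
    then have "a \<in> I_set s t n" by (simp add: I_set_def)
    note le = T3_G1_le[OF this, folded a(1,2)] T3_G2_le[OF this, folded a(1,2)]
    have s1: "int (s - 1) = int s - 1" using \<open>t < s\<close> by simp
    from triangles_ge_matching[OF A(1,2) inner tau] show False
    proof
      assume "s * card (V - A) \<le> card (triangles V E) + card (missing A (V - A))"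
      then have "int s * int (card (V - A))
          \<le> int (card (triangles V E)) + int (card (missing A (V - A)))"
        by (metis of_nat_add of_nat_le_iff of_nat_mult)
      then show False using le(2) few(2) M by linarith
    next
      assume "(s - 1) * card (V - A) + card A
        \<le> card (triangles V E) + 2 * card (missing A (V - A))"
      then have "int (s - 1) * int (card (V - A)) + int (card A)
          \<le> int (card (triangles V E)) + 2 * int (card (missing A (V - A)))"
        by (simp only: of_nat_add of_nat_mult of_nat_numeral flip: zle_int)
      then show False using le(1) few(1) M s1 by simp
    qed
  qed
qed

end
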